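(* Let $n\ge1$ and let $\vec x=(x_1,\dots,x_n)$, $\vec y=(y_1,\dots,y_n)$ be vectors in $\mathbb C^n$. Put $x_0=\frac1n\sum_{k=1}^nx_k$ and $y_0=\frac1n\sum_{k=1}^ny_k$. Then the isometric deviation of $\vec x$ from $\vec y$ is $$d(\mathbb T\vec x+\mathbb C,\vec y)=\sqrt{\|\vec x-x_0\|^2+\|\vec y-y_0\|^2-2\,|\langle\vec x-x_0|\vec y-y_0\rangle|}=d(a(\vec x-x_0),\vec y-y_0),$$ where $a=\dfrac{\overline{\langle\vec x-x_0|\vec y-y_0\rangle}}{|\langle\vec x-x_0|\vec y-y_0\rangle|}$ if $\langle\vec x-x_0|\vec y-y_0\rangle\ne0$, and $a$ is any element of $\mathbb T$ if $\langle\vec x-x_0|\vec y-y_0\rangle=0$.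
   Context: $\mathbb T=\{z\in\mathbb C:|z|=1\}$. For $\vec x,\vec y\in\mathbb C^n$: $\langle\vec x|\vec y\rangle=\sum_{k=1}^nx_k\overline{y_k}$, $\|\vec x\|=\sqrt{\langle\vec x|\vec x\rangle}$, $d(\vec x,\vec y)=\|\vec x-\vec y\|$. For $z\in\mathbb C$, $\vec x+z=(x_1+z,\dots,x_n+z)$ and $\vec x-z=\vec x+(-z)$. The isometric deviation is $d(\mathbb T\vec x+\mathbb C,\vec y)=\inf\{d(a\vec x+b,\vec y):a\in\mathbb T,\ b\in\mathbb C\}$. *)

theory Defs
  imports "HOL-Analysis.Analysis"
begin

text \<open>
  Vectors of dimension \<open>n\<close> are elements of \<open>complex ^ 'n\<close> with \<open>n = CARD('n)\<close>, so \<open>n \<ge> 1\<close> holds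
  automatically. The library operation \<open>vec z\<close> is the vector all of whose entries are \<open>z\<close>; the
  translates of \<open>x\<close> by scalars are thus \<open>x + vec z\<close> and \<open>x - vec z\<close>, and \<open>a *s x\<close> is
  multiplication by a complex scalar.
\<close>

text \<open>The library inner product \<open>\<bullet>\<close> on \<open>complex ^ 'n\<close> is real valued, namely the real part of this
  one. The Hermitian product here is linear in its first argument.\<close>

definition hinner :: "complex ^ 'n \<Rightarrow> complex ^ 'n \<Rightarrow> complex"
  where "hinner x y = (\<Sum>k\<in>UNIV. x $ k * cnj (y $ k))"

text \<open>The infimum is of a nonempty set of reals bounded below by \<open>0\<close>.\<close>

definition isometric_deviation :: "complex ^ 'n \<Rightarrow> complex ^ 'n \<Rightarrow> real"
  where "isometric_deviation x y = Inf {dist (a *s x + vec b) y | a b. a \<in> sphere 0 1}"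

text \<open>The library norm is the norm of the Hermitian product, and \<open>dist\<close> is its metric
  (\<open>dist_norm\<close>).\<close>

lemma hinner_self: "hinner x x = complex_of_real ((norm x)\<^sup>2)"
  by (simp add: hinner_def norm_vec_def L2_set_def sum_nonneg complex_norm_square del: of_real_power)

lemma norm_eq_sqrt_hinner: "norm x = sqrt (Re (hinner x x))"
  by (simp add: hinner_self del: of_real_power)

lemma vec_translate_nth: "(x + vec z) $ k = x $ k + z" "x - vec z = x + vec (- z)"
  for x :: "complex ^ 'n"
  by (simp_all add: vec_eq_iff)

end

theory Submission
  imports Defs
begin

text \<open>
  Write \<open>u = x - vec x0\<close> and \<open>v = y - vec y0\<close> for the centred vectors. A competitor differs from
  \<open>y\<close> by \<open>a *s x + vec b - y = (a *s u - v) + vec c\<close> with \<open>c = a * x0 + b - y0\<close>. The entries of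
  \<open>a *s u - v\<close> sum to zero, so this is an orthogonal decomposition, and Pythagoras
  (\<open>norm_le_norm_add_vec_of_centred\<close>) makes \<open>c = 0\<close> the best translation for every \<open>a\<close>: the
  problem is reduced to minimising \<open>norm (a *s u - v)\<close> over unit scalars.

  For these, the law of cosines (\<open>norm_rotate_diff_square\<close>) leaves only the term
  \<open>- 2 * Re (a * hinner u v)\<close> depending on \<open>a\<close>. Since \<open>Re w \<le> cmod w\<close>, it is at least
  \<open>- 2 * cmod (hinner u v)\<close>, with equality when \<open>a\<close> turns \<open>hinner u v\<close> onto the nonnegative real
  axis. The infimum is therefore a minimum, attained at that rotation together with \<open>c = 0\<close>.
\<close>

lemma Re_hinner: "Re (hinner u v) = u \<bullet> v"
  by (simp add: hinner_def inner_vec_def inner_complex_def)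

lemma hinner_scale_left: "hinner (a *s u) v = a * hinner u v"
  by (simp add: hinner_def sum_distrib_left mult.assoc)

lemma norm_rotate:
  fixes u :: "complex ^ 'n"
  assumes "cmod a = 1"
  shows "norm (a *s u) = norm u"
  using assms by (simp add: norm_vec_def L2_set_def norm_mult)

lemma norm_rotate_diff_square:
  assumes "cmod a = 1"
  shows "(norm (a *s u - v))\<^sup>2 = (norm u)\<^sup>2 + (norm v)\<^sup>2 - 2 * Re (a * hinner u v)"
proof -
  have "(norm (a *s u - v))\<^sup>2 = (norm (a *s u))\<^sup>2 + (norm v)\<^sup>2 - 2 * ((a *s u) \<bullet> v)"
    by (simp add: power2_norm_eq_inner inner_diff_left inner_diff_right inner_commute)
  then show ?thesis
    by (simp add: norm_rotate[OF assms] hinner_scale_left flip: Re_hinner)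
qed

lemma sum_centred_eq_0:
  fixes x :: "complex ^ 'n"
  assumes "m = (1 / of_nat CARD('n)) * (\<Sum>k\<in>UNIV. x $ k)"
  shows "(\<Sum>k\<in>UNIV. (x - vec m) $ k) = 0"
  using assms by (simp add: sum_subtractf)

text \<open>The constant vectors are orthogonal to the vectors whose entries sum to zero.\<close>

lemma norm_le_norm_add_vec_of_centred:
  fixes w :: "complex ^ 'n"
  assumes "(\<Sum>k\<in>UNIV. w $ k) = 0"
  shows "norm w \<le> norm (w + vec c)"
proof -
  have "hinner w (vec c) = 0"
    using assms by (simp add: hinner_def flip: sum_distrib_right)
  then have "w \<bullet> vec c = 0"
    by (simp flip: Re_hinner)
  then have "(norm (w + vec c))\<^sup>2 = (norm w)\<^sup>2 + (norm (vec c :: complex ^ 'n))\<^sup>2"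
    by (simp add: power2_norm_eq_inner inner_add_left inner_add_right inner_commute)
  then show ?thesis
    by (simp add: power2_le_imp_le)
qed

lemma Re_mult_le_cmod:
  assumes "cmod a = 1"
  shows "Re (a * h) \<le> cmod h"
  using complex_Re_le_cmod[of "a * h"] assms by (simp add: norm_mult)

theorem theorem2:
  fixes x y :: "complex ^ 'n" and x0 y0 :: complex
  assumes "x0 = (1 / of_nat CARD('n)) * (\<Sum>k\<in>UNIV. x $ k)"
    and "y0 = (1 / of_nat CARD('n)) * (\<Sum>k\<in>UNIV. y $ k)"
  shows "isometric_deviation x y =
           sqrt ((norm (x - vec x0))\<^sup>2 + (norm (y - vec y0))\<^sup>2
                 - 2 * cmod (hinner (x - vec x0) (y - vec y0)))
       \<and> (\<forall>a. (if hinner (x - vec x0) (y - vec y0) \<noteq> 0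
               then a = cnj (hinner (x - vec x0) (y - vec y0))
                        / complex_of_real (cmod (hinner (x - vec x0) (y - vec y0)))
               else a \<in> sphere 0 1) \<longrightarrow>
             sqrt ((norm (x - vec x0))\<^sup>2 + (norm (y - vec y0))\<^sup>2
                   - 2 * cmod (hinner (x - vec x0) (y - vec y0)))
             = dist (a *s (x - vec x0)) (y - vec y0))"
proof -
  define u where "u = x - vec x0"
  define v where "v = y - vec y0"
  define h where "h = hinner u v"
  define D where "D = sqrt ((norm u)\<^sup>2 + (norm v)\<^sup>2 - 2 * cmod h)"
  define optimal where
    "optimal a = (if h \<noteq> 0 then a = cnj h / complex_of_real (cmod h) else a \<in> sphere 0 1)" for a
  have lower: "D \<le> norm (a *s u - v)" if "cmod a = 1" for a
    using Re_mult_le_cmod[OF that, of h] unfolding D_def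
    by (intro real_le_lsqrt) (simp_all add: norm_rotate_diff_square[OF that] flip: h_def)
  have unit: "cmod a = 1" if "optimal a" for a
    using that by (auto simp: optimal_def norm_divide split: if_splits)
  have attained: "D = norm (a *s u - v)" if "optimal a" for a
  proof -
    have "Re (a * h) = cmod h"
    proof (cases "h = 0")
      case False
      have "a * h = complex_of_real ((cmod h)\<^sup>2) / complex_of_real (cmod h)"
        using that False
        by (simp add: optimal_def complex_norm_square mult.commute del: of_real_power)
      then show ?thesis
        using False by (simp add: power2_eq_square)
    qed simp
    then show ?thesis
      unfolding D_def using norm_rotate_diff_square[OF unit[OF that], of u v]
      by (intro real_sqrt_unique) (simp_all add: h_def)
  qed
  have split: "a *s x + vec b - y = (a *s u - v) + vec (a * x0 + b - y0)" for a b
    by (simp add: vec_eq_iff u_def v_def algebra_simps)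
  have "(\<Sum>k\<in>UNIV. (a *s u - v) $ k) = 0" for a
    using sum_centred_eq_0[OF assms(1)] sum_centred_eq_0[OF assms(2)]
    unfolding u_def[symmetric] v_def[symmetric]
    by (simp add: sum_subtractf flip: sum_distrib_left)
  then have translate: "norm (a *s u - v) \<le> dist (a *s x + vec b) y" for a b
    unfolding dist_norm split by (rule norm_le_norm_add_vec_of_centred)
  obtain a where a: "optimal a"
    unfolding optimal_def using norm_one mem_sphere_0 by metis
  have "isometric_deviation x y = D"
    unfolding isometric_deviation_def
  proof (rule cInf_eq_minimum)
    \<comment> \<open>The translation that carries \<open>a * x0\<close> to \<open>y0\<close> aligns the centroids.\<close>
    have "dist (a *s x + vec (y0 - a * x0)) y = D"
      unfolding dist_norm split by (simp add: attained[OF a])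
    then show "D \<in> {dist (a *s x + vec b) y | a b. a \<in> sphere 0 1}"
      using unit[OF a] by (metis (mono_tags, lifting) mem_Collect_eq mem_sphere_0)
  next
    fix r
    assume "r \<in> {dist (a *s x + vec b) y | a b. a \<in> sphere 0 1}"
    then show "D \<le> r"
      using order_trans[OF lower translate] by auto
  qed
  then show ?thesis
    using attained
    unfolding D_def optimal_def h_def u_def v_def by (simp add: dist_norm)
qed

end
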